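(* Let $s,r\in\mathbb N_+$, $\beta,\lambda>0$, and let $(a_{ij})_{i,j=1}^s,(b_i)_{i=1}^s$ and $(\tilde a_{mn})_{m,n=1}^r,(\tilde b_m)_{m=1}^r$ be real Runge--Kutta coefficients. Consider the splitting Runge--Kutta method for the stochastic Korteweg--de Vries equation given, for $i=1,\dots,s$ and $m=1,\dots,r$, by \begin{align*} &V_i^m=v_0^m+\Delta x\sum_{j=1}^sa_{ij}\,\delta_xV_j^m,\qquad \mathcal W_i^m=w_0^m+\Delta x\sum_{j=1}^sa_{ij}\,\delta_x\mathcal W_j^m,\\ &U_i^m=u_0^m+\Delta x\sum_{j=1}^sa_{ij}\mathcal W_j^m,\qquad \mathcal P_i^m=\rho_0^m+\Delta x\sum_{j=1}^sa_{ij}U_j^m,\\ &\overline v_1^m=v_0^m+\Delta x\sum_{i=1}^sb_i\,\delta_xV_i^m,\qquad \overline w_1^m=w_0^m+\Delta x\sum_{i=1}^sb_i\,\delta_x\mathcal W_i^m,\\ &\overline u_1^m=u_0^m+\Delta x\sum_{i=1}^sb_i\mathcal W_i^m,\qquad \overline\rho_1^m=\rho_0^m+\Delta x\sum_{i=1}^sb_iU_i^m,\\ &U_i^m=u_i^0+\Delta t\sum_{n=1}^r\tilde a_{mn}\big(-2\,\delta_xV_i^n\big),\qquad \mathcal P_i^m=\rho_i^0+\Delta t\sum_{n=1}^r\tilde a_{mn}\big(-2\beta\,\delta_x\mathcal W_i^n+2V_i^n-(U_i^n)^2\big),\\ &\overline u_i^1=u_i^0+\Delta t\sum_{m=1}^r\tilde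 b_m\big(-2\,\delta_xV_i^m\big),\qquad \overline\rho_i^1=\rho_i^0+\Delta t\sum_{m=1}^r\tilde b_m\big(-2\beta\,\delta_x\mathcal W_i^m+2V_i^m-(U_i^m)^2\big),\\ &v_1^m=\overline v_1^m,\quad w_1^m=\overline w_1^m,\quad u_1^m=\overline u_1^m,\quad \rho_1^m=\overline\rho_1^m,\qquad \rho_i^1=\overline\rho_i^1,\quad u_i^1=\overline u_i^1+2\lambda\,\Delta W_i^1 . \end{align*} Assume the symplectic condition $$b_ib_j-b_ia_{ij}-b_ja_{ji}=0\quad(1\le i,j\le s),\qquad \tilde b_m\tilde b_n-\tilde b_m\tilde a_{mn}-\tilde b_n\tilde a_{nm}=0\quad(1\le m,n\le r).$$ Then the method preserves, almost surely, the discrete multi-symplectic conservation law $$\sum_{i=1}^s\frac{b_i}{\Delta t}\big(\mathrm d\rho_i^1\wedge\mathrm du_i^1-\mathrm d\rho_i^0\wedge\mathrm du_i^0\big)+\sum_{m=1}^r\frac{2\tilde b_m}{\Delta x}\big(\mathrm d\rho_1^m\wedge\mathrm dv_1^m-\mathrm d\rho_0^m\wedge\mathrm dv_0^m+\beta\,\mathrm dw_1^m\wedge\mathrm du_1^m-\beta\,\mathrm dw_0^m\wedge\mathrm du_0^m\big)=0 .$$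
   Context: The stochastic KdV equation is $du+uu_x\,dt+\beta u_{xxx}\,dt=\lambda\,dW(t)$, $\beta,\lambda>0$, rewritten as $-\frac12d\rho-\beta w_x\,dt=\frac12u^2\,dt-v\,dt$, $\rho_x=u$, $\frac12du+v_x\,dt=\lambda\,dW(t)$, $u_x=w$. $W$ is a real $L^2$-valued $Q$-Wiener process with trace-class $Q$. The method treats one space-time cell $[0,\Delta x]\times[0,\Delta t]$: the deterministic part is discretized by Runge--Kutta methods in space and time, the remaining stochastic part ($du=2\lambda\,dW$, $\rho_t=0$) by the symplectic Euler method. All quantities are real numbers for each realization of the noise. Stage quantities $U_i^m,V_i^m,\mathcal P_i^m,\mathcal W_i^m$ approximate $u,v,\rho,w$ at $(c_i\Delta x,\tilde c_m\Delta t)$, $c_i=\sum_ja_{ij}$, $\tilde c_m=\sum_n\tilde a_{mn}$; $\delta_xV_i^m,\delta_x\mathcal W_i^m$ are the stage quantities discretizing $\partial_xv,\partial_xw$. Superscripts $0,1$ on $u_i,\rho_i$ refer to times $0,\Delta t$ at $x=c_i\Delta x$; subscripts $0,1$ on $u^m,v^m,\rho^m,w^m$ refer to $x=0,\Delta x$ at time $\tilde c_m\Delta t$ (quantities indexed by a spatial stage and by a temporal stage are different families). $\Delta W_i^1=W(c_i\Delta x,\Delta t)-W(c_i\Delta x,0)$. $\mathrm d$ (roman) is the exterior derivative: for a fixed realization of the noise, all numerical quantities are regarded as differentiable functions of parameters (e.g. the data), so their differentials satisfy the linearized scheme and noise increments carry no differential. *)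

theory Defs
  imports "HOL-Probability.Probability"
begin

section \<open>The driving noise\<close>

text \<open>
  Elements of \<open>L\<^sup>2(D)\<close> are handled through representatives, i.e. real functions on the
  line of which only the restriction to \<open>D\<close> matters; equality in \<open>L\<^sup>2(D)\<close> is equality
  almost everywhere on \<open>D\<close>.
\<close>

definition L2 :: "real set \<Rightarrow> (real \<Rightarrow> real) set" where
  "L2 D = {f. f \<in> borel_measurable (lebesgue_on D) \<and>
              integrable (lebesgue_on D) (\<lambda>x. (f x)\<^sup>2)}"

definition L2_inner :: "real set \<Rightarrow> (real \<Rightarrow> real) \<Rightarrow> (real \<Rightarrow> real) \<Rightarrow> real" where
  "L2_inner D f g = (LINT x|lebesgue_on D. f x * g x)"

definition L2_norm :: "real set \<Rightarrow> (real \<Rightarrow> real) \<Rightarrow> real" where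
  "L2_norm D f = sqrt (L2_inner D f f)"

definition L2_orthonormal_basis :: "real set \<Rightarrow> (nat \<Rightarrow> real \<Rightarrow> real) \<Rightarrow> bool" where
  "L2_orthonormal_basis D e \<longleftrightarrow>
     (\<forall>k. e k \<in> L2 D) \<and>
     (\<forall>k l. L2_inner D (e k) (e l) = (if k = l then 1 else 0)) \<and>
     (\<forall>f\<in>L2 D. (\<lambda>n. L2_norm D (\<lambda>x. f x - (\<Sum>k<n. L2_inner D f (e k) * e k x))) \<longlonglongrightarrow> 0)"

text \<open>
  Covariance operators: linear, symmetric and nonnegative on \<open>L\<^sup>2(D)\<close>, with finite trace.
  Boundedness is automatic, and for a nonnegative operator the value of the trace does not
  depend on the orthonormal basis.
\<close>

definition trace_class_covariance ::
    "real set \<Rightarrow> ((real \<Rightarrow> real) \<Rightarrow> real \<Rightarrow> real) \<Rightarrow> bool" where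
  "trace_class_covariance D Q \<longleftrightarrow>
     (\<forall>f\<in>L2 D. Q f \<in> L2 D) \<and>
     (\<forall>f\<in>L2 D. \<forall>g\<in>L2 D. \<forall>\<alpha> \<gamma>. AE x in lebesgue_on D.
        Q (\<lambda>y. \<alpha> * f y + \<gamma> * g y) x = \<alpha> * Q f x + \<gamma> * Q g x) \<and>
     (\<forall>f\<in>L2 D. \<forall>g\<in>L2 D. L2_inner D (Q f) g = L2_inner D f (Q g)) \<and>
     (\<forall>f\<in>L2 D. 0 \<le> L2_inner D (Q f) f) \<and>
     (\<exists>e. L2_orthonormal_basis D e \<and> summable (\<lambda>k. L2_inner D (Q (e k)) (e k)))"

text \<open>The law \<open>N(0, v)\<close>; for \<open>v = 0\<close> it is the point mass at \<open>0\<close> and has no density.\<close>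

definition centered_gaussian :: "'w measure \<Rightarrow> ('w \<Rightarrow> real) \<Rightarrow> real \<Rightarrow> bool" where
  "centered_gaussian M X v \<longleftrightarrow>
     (if v = 0 then X \<in> borel_measurable M \<and> (AE \<omega> in M. X \<omega> = 0)
      else distributed M lborel X (\<lambda>x. ennreal (normal_density 0 (sqrt v) x)))"

text \<open>
  \<open>W t \<omega> x\<close> is the value at the point \<open>x\<close> of a representative of \<open>W(t) \<in> L\<^sup>2(D)\<close> for the
  realization \<open>\<omega>\<close>; times range over \<open>t \<ge> 0\<close>. As \<open>L\<^sup>2(D)\<close> is separable, its Borel
  \<open>\<sigma>\<close>-algebra is generated by the functionals \<open>\<langle>_, f\<rangle>\<close>. Measurability and independence of
  \<open>L\<^sup>2(D)\<close>-valued random variables are therefore expressed through the family of all such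
  functionals, and a random variable has the law \<open>N(0, (t - s) Q)\<close> iff its pairing with every
  \<open>f\<close> has the law \<open>N(0, (t - s) \<langle>Q f, f\<rangle>)\<close>.
\<close>

definition Q_Wiener_process ::
    "'w measure \<Rightarrow> real set \<Rightarrow> ((real \<Rightarrow> real) \<Rightarrow> real \<Rightarrow> real) \<Rightarrow>
     (real \<Rightarrow> 'w \<Rightarrow> real \<Rightarrow> real) \<Rightarrow> bool" where
  "Q_Wiener_process M D Q W \<longleftrightarrow>
     prob_space M \<and> D \<in> sets lebesgue \<and> trace_class_covariance D Q \<and>
     (\<forall>t\<ge>0. \<forall>\<omega>\<in>space M. W t \<omega> \<in> L2 D) \<and>
     (\<forall>t\<ge>0. \<forall>f\<in>L2 D. (\<lambda>\<omega>. L2_inner D (W t \<omega>) f) \<in> borel_measurable M) \<and>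
     (AE \<omega> in M. AE x in lebesgue_on D. W 0 \<omega> x = 0) \<and>
     (AE \<omega> in M. \<forall>t\<ge>0.
        ((\<lambda>s. L2_norm D (\<lambda>x. W s \<omega> x - W t \<omega> x)) \<longlongrightarrow> 0) (at t within {0..})) \<and>
     (\<forall>n t. 0 \<le> t 0 \<and> (\<forall>k<n. t k < t (Suc k)) \<longrightarrow>
        prob_space.indep_vars M (\<lambda>_. Pi\<^sub>M (L2 D) (\<lambda>_. borel))
          (\<lambda>k \<omega>. \<lambda>f\<in>L2 D. L2_inner D (\<lambda>x. W (t (Suc k)) \<omega> x - W (t k) \<omega> x) f) {..<n}) \<and>
     (\<forall>s t. 0 \<le> s \<and> s < t \<longrightarrow> (\<forall>f\<in>L2 D.
        centered_gaussian M (\<lambda>\<omega>. L2_inner D (\<lambda>x. W t \<omega> x - W s \<omega> x) f)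
          ((t - s) * L2_inner D (Q f) f)))"


section \<open>The method on one space-time cell\<close>

text \<open>
  All numerical quantities on the cell \<open>[0,\<Delta>x] \<times> [0,\<Delta>t]\<close>. The \<open>stage_\<close> fields take a spatial
  index \<open>i\<close> and a temporal index \<open>m\<close>; \<open>stage_vx\<close> and \<open>stage_wx\<close> are \<open>\<delta>\<^sub>xV\<^sub>i\<^sup>m\<close> and
  \<open>\<delta>\<^sub>x\<W>\<^sub>i\<^sup>m\<close>. The suffixes \<open>left\<close>, \<open>right\<close> stand for \<open>x = 0\<close>, \<open>x = \<Delta>x\<close> and take
  \<open>m\<close>; the suffixes \<open>init\<close>, \<open>fin\<close> stand for the times \<open>0\<close>, \<open>\<Delta>t\<close> and take \<open>i\<close>.
  Barred quantities are those of the deterministic substep.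
\<close>

record kdv_cell =
  stage_v :: "nat \<Rightarrow> nat \<Rightarrow> real"
  stage_w :: "nat \<Rightarrow> nat \<Rightarrow> real"
  stage_u :: "nat \<Rightarrow> nat \<Rightarrow> real"
  stage_rho :: "nat \<Rightarrow> nat \<Rightarrow> real"
  stage_vx :: "nat \<Rightarrow> nat \<Rightarrow> real"
  stage_wx :: "nat \<Rightarrow> nat \<Rightarrow> real"
  v_left :: "nat \<Rightarrow> real"
  w_left :: "nat \<Rightarrow> real"
  u_left :: "nat \<Rightarrow> real"
  rho_left :: "nat \<Rightarrow> real"
  vbar_right :: "nat \<Rightarrow> real"
  wbar_right :: "nat \<Rightarrow> real"
  ubar_right :: "nat \<Rightarrow> real"
  rhobar_right :: "nat \<Rightarrow> real"
  v_right :: "nat \<Rightarrow> real"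
  w_right :: "nat \<Rightarrow> real"
  u_right :: "nat \<Rightarrow> real"
  rho_right :: "nat \<Rightarrow> real"
  u_init :: "nat \<Rightarrow> real"
  rho_init :: "nat \<Rightarrow> real"
  ubar_fin :: "nat \<Rightarrow> real"
  rhobar_fin :: "nat \<Rightarrow> real"
  u_fin :: "nat \<Rightarrow> real"
  rho_fin :: "nat \<Rightarrow> real"

text \<open>The abscissae \<open>c\<^sub>i\<close>.\<close>

definition rk_abscissa :: "nat \<Rightarrow> (nat \<Rightarrow> nat \<Rightarrow> real) \<Rightarrow> nat \<Rightarrow> real" where
  "rk_abscissa s a i = (\<Sum>j=1..s. a i j)"

definition rk_symplectic :: "nat \<Rightarrow> (nat \<Rightarrow> nat \<Rightarrow> real) \<Rightarrow> (nat \<Rightarrow> real) \<Rightarrow> bool" where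
  "rk_symplectic s a b \<longleftrightarrow>
     (\<forall>i\<in>{1..s}. \<forall>j\<in>{1..s}. b i * b j - b i * a i j - b j * a j i = 0)"

text \<open>The argument \<open>dW\<close> is the family of noise increments \<open>\<Delta>W\<^sub>i\<^sup>1\<close> of one realization.\<close>

definition splitting_rk ::
    "nat \<Rightarrow> (nat \<Rightarrow> nat \<Rightarrow> real) \<Rightarrow> (nat \<Rightarrow> real) \<Rightarrow>
     nat \<Rightarrow> (nat \<Rightarrow> nat \<Rightarrow> real) \<Rightarrow> (nat \<Rightarrow> real) \<Rightarrow>
     real \<Rightarrow> real \<Rightarrow> real \<Rightarrow> real \<Rightarrow> (nat \<Rightarrow> real) \<Rightarrow> kdv_cell \<Rightarrow> bool" where
  "splitting_rk s a b r a' b' dx dt \<beta> lam dW X \<longleftrightarrow>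
     (\<forall>i\<in>{1..s}. \<forall>m\<in>{1..r}.
        stage_v X i m = v_left X m + dx * (\<Sum>j=1..s. a i j * stage_vx X j m) \<and>
        stage_w X i m = w_left X m + dx * (\<Sum>j=1..s. a i j * stage_wx X j m) \<and>
        stage_u X i m = u_left X m + dx * (\<Sum>j=1..s. a i j * stage_w X j m) \<and>
        stage_rho X i m = rho_left X m + dx * (\<Sum>j=1..s. a i j * stage_u X j m) \<and>
        stage_u X i m = u_init X i + dt * (\<Sum>n=1..r. a' m n * (- 2 * stage_vx X i n)) \<and>
        stage_rho X i m = rho_init X i + dt * (\<Sum>n=1..r. a' m n *
          (- 2 * \<beta> * stage_wx X i n + 2 * stage_v X i n - (stage_u X i n)\<^sup>2))) \<and>
     (\<forall>m\<in>{1..r}.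
        vbar_right X m = v_left X m + dx * (\<Sum>i=1..s. b i * stage_vx X i m) \<and>
        wbar_right X m = w_left X m + dx * (\<Sum>i=1..s. b i * stage_wx X i m) \<and>
        ubar_right X m = u_left X m + dx * (\<Sum>i=1..s. b i * stage_w X i m) \<and>
        rhobar_right X m = rho_left X m + dx * (\<Sum>i=1..s. b i * stage_u X i m) \<and>
        v_right X m = vbar_right X m \<and>
        w_right X m = wbar_right X m \<and>
        u_right X m = ubar_right X m \<and>
        rho_right X m = rhobar_right X m) \<and>
     (\<forall>i\<in>{1..s}.
        ubar_fin X i = u_init X i + dt * (\<Sum>m=1..r. b' m * (- 2 * stage_vx X i m)) \<and>
        rhobar_fin X i = rho_init X i + dt * (\<Sum>m=1..r. b' m *
          (- 2 * \<beta> * stage_wx X i m + 2 * stage_v X i m - (stage_u X i m)\<^sup>2)) \<and>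
        rho_fin X i = rhobar_fin X i \<and>
        u_fin X i = ubar_fin X i + 2 * lam * dW i)"


section \<open>Differentials with respect to parameters\<close>

text \<open>
  For a fixed realization, \<open>X p\<close> collects the numerical quantities belonging to the parameter
  \<open>p\<close>. A quantity is selected by a function \<open>q\<close> on cells, e.g. \<open>\<lambda>Y. u_fin Y i\<close>, and its
  exterior derivative at \<open>p\<close> is the 1-form \<open>cell_d X p q\<close>.
\<close>

definition cell_differentiable_at ::
    "nat \<Rightarrow> nat \<Rightarrow> ('p::real_normed_vector \<Rightarrow> kdv_cell) \<Rightarrow> 'p \<Rightarrow> bool" where
  "cell_differentiable_at s r X p \<longleftrightarrow>
     (\<forall>q\<in>{stage_v, stage_w, stage_u, stage_rho, stage_vx, stage_wx}.
        \<forall>i\<in>{1..s}. \<forall>m\<in>{1..r}. (\<lambda>p'. q (X p') i m) differentiable (at p)) \<and>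
     (\<forall>q\<in>{v_left, w_left, u_left, rho_left, vbar_right, wbar_right, ubar_right, rhobar_right,
            v_right, w_right, u_right, rho_right}.
        \<forall>m\<in>{1..r}. (\<lambda>p'. q (X p') m) differentiable (at p)) \<and>
     (\<forall>q\<in>{u_init, rho_init, ubar_fin, rhobar_fin, u_fin, rho_fin}.
        \<forall>i\<in>{1..s}. (\<lambda>p'. q (X p') i) differentiable (at p))"

definition cell_d ::
    "('p::real_normed_vector \<Rightarrow> kdv_cell) \<Rightarrow> 'p \<Rightarrow> (kdv_cell \<Rightarrow> real) \<Rightarrow> 'p \<Rightarrow> real" where
  "cell_d X p q = frechet_derivative (\<lambda>p'. q (X p')) (at p)"

definition wedge :: "('p \<Rightarrow> real) \<Rightarrow> ('p \<Rightarrow> real) \<Rightarrow> 'p \<Rightarrow> 'p \<Rightarrow> real"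
    (infix "\<^bold>\<and>" 75) where
  "(\<phi> \<^bold>\<and> \<psi>) = (\<lambda>\<xi> \<eta>. \<phi> \<xi> * \<psi> \<eta> - \<phi> \<eta> * \<psi> \<xi>)"

end

theory Submission
  imports Defs
begin

text \<open>
  A Runge--Kutta method whose coefficients satisfy the symplectic condition obeys an exact
  discrete Leibniz rule for bilinear quantities, hence for wedge products of solutions of the
  linearized scheme. Applied in time to \<open>d\<rho> \<and> du\<close> and in space to \<open>d\<rho> \<and> dv\<close> and \<open>dw \<and> du\<close>, it
  turns the conservation law into a double sum over the stages whose summands vanish: the
  quadratic term contributes \<open>U dU \<and> dU = 0\<close>, and the other terms cancel in pairs. The noise is
  additive and does not depend on the parameters, so it disappears from the differentials.
\<close>

section \<open>Discrete Leibniz rule for symplectic Runge--Kutta coefficients\<close>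

text \<open>Both sides are polynomials in \<open>h\<close> whose linear parts agree for any
  coefficients. At order \<open>h\<close> squared the left side has the weights
  \<open>b i * b j\<close> on \<open>k i * l j\<close>, and replacing \<open>z0\<close>,
  \<open>y0\<close> by the stage values on the right produces
  \<open>b i * a i j + b j * a j i\<close>. The symplectic condition is exactly the equality of
  these weights.\<close>

lemma rk_symplectic_leibniz:
  fixes y0 y1 z0 z1 h :: real and Y Z k l :: "nat \<Rightarrow> real"
  assumes symp: "rk_symplectic s a b"
    and Y: "\<And>i. i \<in> {1..s} \<Longrightarrow> Y i = y0 + h * (\<Sum>j=1..s. a i j * k j)"
    and Z: "\<And>i. i \<in> {1..s} \<Longrightarrow> Z i = z0 + h * (\<Sum>j=1..s. a i j * l j)"
    and y1: "y1 = y0 + h * (\<Sum>i=1..s. b i * k i)"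
    and z1: "z1 = z0 + h * (\<Sum>i=1..s. b i * l i)"
  shows "y1 * z1 - y0 * z0 = h * (\<Sum>i=1..s. b i * (k i * Z i + Y i * l i))"
proof -
  let ?I = "{1..s}"
  have sum_kZ: "(\<Sum>i\<in>?I. b i * (k i * Z i)) =
      z0 * (\<Sum>i\<in>?I. b i * k i) + h * (\<Sum>i\<in>?I. \<Sum>j\<in>?I. b i * a i j * (k i * l j))"
    by (simp add: Z sum_distrib_left sum.distrib algebra_simps)
  \<comment> \<open>Expanding the stage \<open>Y\<close> in the slopes \<open>k\<close> makes the
    stage index the one carried by \<open>l\<close>. It is called \<open>j\<close> here, and the
    sums are then swapped, so that both double sums have the common factor
    \<open>k i * l j\<close>.\<close>
  have "(\<Sum>i\<in>?I. b i * (Y i * l i)) =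
      y0 * (\<Sum>i\<in>?I. b i * l i) + h * (\<Sum>j\<in>?I. \<Sum>i\<in>?I. b j * a j i * (k i * l j))"
    by (simp add: Y sum_distrib_left sum.distrib algebra_simps)
  also have "(\<Sum>j\<in>?I. \<Sum>i\<in>?I. b j * a j i * (k i * l j)) =
      (\<Sum>i\<in>?I. \<Sum>j\<in>?I. b j * a j i * (k i * l j))"
    by (rule sum.swap)
  finally have sum_Yl: "(\<Sum>i\<in>?I. b i * (Y i * l i)) =
      y0 * (\<Sum>i\<in>?I. b i * l i) + h * (\<Sum>i\<in>?I. \<Sum>j\<in>?I. b j * a j i * (k i * l j))" .
  have "(\<Sum>i\<in>?I. b i * k i) * (\<Sum>j\<in>?I. b j * l j) =
      (\<Sum>i\<in>?I. \<Sum>j\<in>?I. b i * b j * (k i * l j))"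
    by (simp add: sum_product mult_ac)
  also have "\<dots> = (\<Sum>i\<in>?I. \<Sum>j\<in>?I. b i * a i j * (k i * l j) + b j * a j i * (k i * l j))"
  proof (intro sum.cong refl)
    fix i j assume "i \<in> ?I" "j \<in> ?I"
    then have "b i * b j - b i * a i j - b j * a j i = 0"
      using symp unfolding rk_symplectic_def by blast
    then have "b i * b j = b i * a i j + b j * a j i"
      by linarith
    then show "b i * b j * (k i * l j) = b i * a i j * (k i * l j) + b j * a j i * (k i * l j)"
      by (simp only: distrib_right)
  qed
  finally have prod: "(\<Sum>i\<in>?I. b i * k i) * (\<Sum>j\<in>?I. b j * l j) =
      (\<Sum>i\<in>?I. \<Sum>j\<in>?I. b i * a i j * (k i * l j)) +
      (\<Sum>i\<in>?I. \<Sum>j\<in>?I. b j * a j i * (k i * l j))"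
    by (simp add: sum.distrib)
  have "y1 * z1 - y0 * z0 = h * (z0 * (\<Sum>i\<in>?I. b i * k i) + y0 * (\<Sum>i\<in>?I. b i * l i)
      + h * ((\<Sum>i\<in>?I. b i * k i) * (\<Sum>j\<in>?I. b j * l j)))"
    unfolding y1 z1 by (simp add: algebra_simps)
  also have "\<dots> = h * ((\<Sum>i\<in>?I. b i * (k i * Z i)) + (\<Sum>i\<in>?I. b i * (Y i * l i)))"
    unfolding sum_kZ sum_Yl prod by (simp add: algebra_simps)
  finally show ?thesis
    by (simp add: sum.distrib distrib_left)
qed

text \<open>The scalar rule lets its two factors come from different solutions, so it applies with
  the first form evaluated at one vector and the second at another. Antisymmetrizing in the two
  vectors gives the rule for the wedge product.\<close>

lemma rk_symplectic_wedge:
  fixes y0 y1 z0 z1 :: "'p \<Rightarrow> real" and Y Z k l :: "nat \<Rightarrow> 'p \<Rightarrow> real"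
  assumes symp: "rk_symplectic s a b"
    and "\<And>i \<zeta>. i \<in> {1..s} \<Longrightarrow> Y i \<zeta> = y0 \<zeta> + h * (\<Sum>j=1..s. a i j * k j \<zeta>)"
    and "\<And>i \<zeta>. i \<in> {1..s} \<Longrightarrow> Z i \<zeta> = z0 \<zeta> + h * (\<Sum>j=1..s. a i j * l j \<zeta>)"
    and "\<And>\<zeta>. y1 \<zeta> = y0 \<zeta> + h * (\<Sum>i=1..s. b i * k i \<zeta>)"
    and "\<And>\<zeta>. z1 \<zeta> = z0 \<zeta> + h * (\<Sum>i=1..s. b i * l i \<zeta>)"
  shows "(y1 \<^bold>\<and> z1) \<xi> \<eta> - (y0 \<^bold>\<and> z0) \<xi> \<eta> =
    h * (\<Sum>i=1..s. b i * ((k i \<^bold>\<and> Z i) \<xi> \<eta> + (Y i \<^bold>\<and> l i) \<xi> \<eta>))"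
proof -
  have leibniz: "y1 \<zeta> * z1 \<theta> - y0 \<zeta> * z0 \<theta> =
      h * (\<Sum>i=1..s. b i * (k i \<zeta> * Z i \<theta> + Y i \<zeta> * l i \<theta>))" for \<zeta> \<theta>
    by (rule rk_symplectic_leibniz[OF symp]) (use assms in auto)
  have "(y1 \<^bold>\<and> z1) \<xi> \<eta> - (y0 \<^bold>\<and> z0) \<xi> \<eta> =
      (y1 \<xi> * z1 \<eta> - y0 \<xi> * z0 \<eta>) - (y1 \<eta> * z1 \<xi> - y0 \<eta> * z0 \<xi>)"
    by (simp add: wedge_def)
  also have "\<dots> = h * ((\<Sum>i=1..s. b i * (k i \<xi> * Z i \<eta> + Y i \<xi> * l i \<eta>))
      - (\<Sum>i=1..s. b i * (k i \<eta> * Z i \<xi> + Y i \<eta> * l i \<xi>)))"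
    unfolding leibniz by (rule right_diff_distrib[symmetric])
  also have "\<dots> = h * (\<Sum>i=1..s. b i * ((k i \<^bold>\<and> Z i) \<xi> \<eta> + (Y i \<^bold>\<and> l i) \<xi> \<eta>))"
    unfolding sum_subtractf[symmetric] by (simp add: wedge_def algebra_simps)
  finally show ?thesis .
qed

section \<open>Linearization of the scheme\<close>

lemma cell_d_has_derivative:
  assumes "(\<lambda>p'. q (X p')) differentiable (at p)"
  shows "((\<lambda>p'. q (X p')) has_derivative cell_d X p q) (at p)"
  using assms unfolding cell_d_def by (simp add: frechet_derivative_works)

lemma cell_d_eqI:
  assumes "((\<lambda>p'. q (X p')) has_derivative D) (at p)"
  shows "cell_d X p q = D"
  using assms unfolding cell_d_def by (metis frechet_derivative_at)

text \<open>Every equation of the scheme has this shape, so a single lemma linearizes all of them.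
  The equation is required on an open set because it is differentiated. The slopes
  \<open>g j\<close> may be nonlinear functions of the cell, and \<open>e\<close>, which is constant
  in the parameter, leaves room for the noise.\<close>

lemma cell_d_rk_step:
  assumes "open S" "p \<in> S"
    and eq: "\<And>p'. p' \<in> S \<Longrightarrow>
      q (X p') = q0 (X p') + h * (\<Sum>j=1..n. c j * g j (X p')) + e"
    and q0: "(\<lambda>p'. q0 (X p')) differentiable (at p)"
    and g: "\<And>j. j \<in> {1..n} \<Longrightarrow> (\<lambda>p'. g j (X p')) differentiable (at p)"
  shows "cell_d X p q \<zeta> = cell_d X p q0 \<zeta> + h * (\<Sum>j=1..n. c j * cell_d X p (g j) \<zeta>)"
proof -
  \<comment> \<open>The final \<open>0\<close> is the derivative of the constant \<open>e\<close>;
    it is kept so that the sum rule matches syntactically.\<close>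
  let ?D = "\<lambda>\<zeta>. cell_d X p q0 \<zeta> + h * (\<Sum>j=1..n. c j * cell_d X p (g j) \<zeta>) + 0"
  have "((\<lambda>p'. q0 (X p') + h * (\<Sum>j=1..n. c j * g j (X p')) + e) has_derivative ?D) (at p)"
    by (intro has_derivative_add has_derivative_mult_right has_derivative_sum
        has_derivative_const cell_d_has_derivative q0 g)
  then have "((\<lambda>p'. q (X p')) has_derivative ?D) (at p)"
    by (rule has_derivative_transform_within_open[OF _ \<open>open S\<close> \<open>p \<in> S\<close>]) (simp add: eq)
  then show ?thesis
    by (simp add: cell_d_eqI)
qed

text \<open>The barred intermediate values are eliminated here, which brings each update into the
  form expected by \<open>cell_d_rk_step\<close>.\<close>

lemma splitting_rk_equations:
  assumes "splitting_rk s a b r a' b' dx dt \<beta> lam dW X"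
  shows "\<And>i m. i \<in> {1..s} \<Longrightarrow> m \<in> {1..r} \<Longrightarrow>
      stage_v X i m = v_left X m + dx * (\<Sum>j=1..s. a i j * stage_vx X j m)"
    and "\<And>i m. i \<in> {1..s} \<Longrightarrow> m \<in> {1..r} \<Longrightarrow>
      stage_w X i m = w_left X m + dx * (\<Sum>j=1..s. a i j * stage_wx X j m)"
    and "\<And>i m. i \<in> {1..s} \<Longrightarrow> m \<in> {1..r} \<Longrightarrow>
      stage_u X i m = u_left X m + dx * (\<Sum>j=1..s. a i j * stage_w X j m)"
    and "\<And>i m. i \<in> {1..s} \<Longrightarrow> m \<in> {1..r} \<Longrightarrow>
      stage_rho X i m = rho_left X m + dx * (\<Sum>j=1..s. a i j * stage_u X j m)"
    and "\<And>i m. i \<in> {1..s} \<Longrightarrow> m \<in> {1..r} \<Longrightarrow>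
      stage_u X i m = u_init X i + dt * (\<Sum>n=1..r. a' m n * (- 2 * stage_vx X i n))"
    and "\<And>i m. i \<in> {1..s} \<Longrightarrow> m \<in> {1..r} \<Longrightarrow>
      stage_rho X i m = rho_init X i + dt * (\<Sum>n=1..r. a' m n *
        (- 2 * \<beta> * stage_wx X i n + 2 * stage_v X i n - (stage_u X i n)\<^sup>2))"
    and "\<And>m. m \<in> {1..r} \<Longrightarrow> v_right X m = v_left X m + dx * (\<Sum>i=1..s. b i * stage_vx X i m)"
    and "\<And>m. m \<in> {1..r} \<Longrightarrow> w_right X m = w_left X m + dx * (\<Sum>i=1..s. b i * stage_wx X i m)"
    and "\<And>m. m \<in> {1..r} \<Longrightarrow> u_right X m = u_left X m + dx * (\<Sum>i=1..s. b i * stage_w X i m)"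
    and "\<And>m. m \<in> {1..r} \<Longrightarrow> rho_right X m = rho_left X m + dx * (\<Sum>i=1..s. b i * stage_u X i m)"
    and "\<And>i. i \<in> {1..s} \<Longrightarrow>
      u_fin X i = u_init X i + dt * (\<Sum>m=1..r. b' m * (- 2 * stage_vx X i m)) + 2 * lam * dW i"
    and "\<And>i. i \<in> {1..s} \<Longrightarrow>
      rho_fin X i = rho_init X i + dt * (\<Sum>m=1..r. b' m *
        (- 2 * \<beta> * stage_wx X i m + 2 * stage_v X i m - (stage_u X i m)\<^sup>2))"
proof -
  note eqs = assms[unfolded splitting_rk_def]
  note stages = conjunct1[OF eqs, THEN bspec, THEN bspec]
    and time_updates = conjunct2[OF conjunct2[OF eqs], THEN bspec]
  fix i assume i: "i \<in> {1..s}"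
  show "u_fin X i = u_init X i + dt * (\<Sum>m=1..r. b' m * (- 2 * stage_vx X i m)) + 2 * lam * dW i"
    "rho_fin X i = rho_init X i + dt * (\<Sum>m=1..r. b' m *
        (- 2 * \<beta> * stage_wx X i m + 2 * stage_v X i m - (stage_u X i m)\<^sup>2))"
    using time_updates[OF i] by simp_all
  fix m assume m: "m \<in> {1..r}"
  show "stage_v X i m = v_left X m + dx * (\<Sum>j=1..s. a i j * stage_vx X j m)"
    "stage_w X i m = w_left X m + dx * (\<Sum>j=1..s. a i j * stage_wx X j m)"
    "stage_u X i m = u_left X m + dx * (\<Sum>j=1..s. a i j * stage_w X j m)"
    "stage_rho X i m = rho_left X m + dx * (\<Sum>j=1..s. a i j * stage_u X j m)"
    "stage_u X i m = u_init X i + dt * (\<Sum>n=1..r. a' m n * (- 2 * stage_vx X i n))"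
    "stage_rho X i m = rho_init X i + dt * (\<Sum>n=1..r. a' m n *
        (- 2 * \<beta> * stage_wx X i n + 2 * stage_v X i n - (stage_u X i n)\<^sup>2))"
    using stages[OF i m] by blast+
next
  note space_updates =
    conjunct1[OF conjunct2[OF assms[unfolded splitting_rk_def]], THEN bspec]
  fix m assume m: "m \<in> {1..r}"
  show "v_right X m = v_left X m + dx * (\<Sum>i=1..s. b i * stage_vx X i m)"
    "w_right X m = w_left X m + dx * (\<Sum>i=1..s. b i * stage_wx X i m)"
    "u_right X m = u_left X m + dx * (\<Sum>i=1..s. b i * stage_w X i m)"
    "rho_right X m = rho_left X m + dx * (\<Sum>i=1..s. b i * stage_u X i m)"
    using space_updates[OF m] by simp_all
qed

section \<open>The conservation law, first for one realization and then almost surely\<close>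

text \<open>The randomness is frozen: \<open>dW\<close> is one family of numbers shared by all
  parameters in \<open>S\<close>, so what remains is a deterministic identity between
  differentials.\<close>

lemma splitting_rk_multisymplectic:
  fixes X :: "'p::real_normed_vector \<Rightarrow> kdv_cell"
  assumes "dx \<noteq> 0" "dt \<noteq> 0"
    and symp: "rk_symplectic s a b" and symp': "rk_symplectic r a' b'"
    and S: "open S" "p \<in> S"
    and rk: "\<And>p'. p' \<in> S \<Longrightarrow> splitting_rk s a b r a' b' dx dt \<beta> lam dW (X p')"
    and diff: "cell_differentiable_at s r X p"
  defines "d \<equiv> cell_d X p"
  shows "(\<Sum>i=1..s. b i / dt *
          ((d (\<lambda>Y. rho_fin Y i) \<^bold>\<and> d (\<lambda>Y. u_fin Y i)) \<xi> \<eta>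
           - (d (\<lambda>Y. rho_init Y i) \<^bold>\<and> d (\<lambda>Y. u_init Y i)) \<xi> \<eta>))
       + (\<Sum>m=1..r. 2 * b' m / dx *
          ((d (\<lambda>Y. rho_right Y m) \<^bold>\<and> d (\<lambda>Y. v_right Y m)) \<xi> \<eta>
           - (d (\<lambda>Y. rho_left Y m) \<^bold>\<and> d (\<lambda>Y. v_left Y m)) \<xi> \<eta>
           + \<beta> * (d (\<lambda>Y. w_right Y m) \<^bold>\<and> d (\<lambda>Y. u_right Y m)) \<xi> \<eta>
           - \<beta> * (d (\<lambda>Y. w_left Y m) \<^bold>\<and> d (\<lambda>Y. u_left Y m)) \<xi> \<eta>))
     = 0"
proof -
  \<comment> \<open>These are the 1-forms of the stage quantities; \<open>W\<close> belongs to the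
    stage values of w and is not the noise.\<close>
  define V W U P Vx Wx where
    "V = (\<lambda>i m. d (\<lambda>Y. stage_v Y i m))" and "W = (\<lambda>i m. d (\<lambda>Y. stage_w Y i m))" and
    "U = (\<lambda>i m. d (\<lambda>Y. stage_u Y i m))" and "P = (\<lambda>i m. d (\<lambda>Y. stage_rho Y i m))" and
    "Vx = (\<lambda>i m. d (\<lambda>Y. stage_vx Y i m))" and "Wx = (\<lambda>i m. d (\<lambda>Y. stage_wx Y i m))"
  note stage_defs = V_def W_def U_def P_def Vx_def Wx_def
  \<comment> \<open>The right-hand sides of the two time equations are written as functions on
    cells, so that \<open>cell_d\<close> applies to them like to any other quantity.\<close>
  define fu frho where
    "fu = (\<lambda>i m (Y::kdv_cell). - 2 * stage_vx Y i m)" and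
    "frho = (\<lambda>i m (Y::kdv_cell). - 2 * \<beta> * stage_wx Y i m + 2 * stage_v Y i m - (stage_u Y i m)\<^sup>2)"

  have diff_stage:
    "(\<lambda>p'. stage_v (X p') i m) differentiable (at p)"
    "(\<lambda>p'. stage_w (X p') i m) differentiable (at p)"
    "(\<lambda>p'. stage_u (X p') i m) differentiable (at p)"
    "(\<lambda>p'. stage_vx (X p') i m) differentiable (at p)"
    "(\<lambda>p'. stage_wx (X p') i m) differentiable (at p)"
    if "i \<in> {1..s}" "m \<in> {1..r}" for i m
    using diff that unfolding cell_differentiable_at_def by auto
  have diff_left:
    "(\<lambda>p'. v_left (X p') m) differentiable (at p)"
    "(\<lambda>p'. w_left (X p') m) differentiable (at p)"
    "(\<lambda>p'. u_left (X p') m) differentiable (at p)"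
    "(\<lambda>p'. rho_left (X p') m) differentiable (at p)"
    if "m \<in> {1..r}" for m
    using diff that unfolding cell_differentiable_at_def by auto
  have diff_init:
    "(\<lambda>p'. u_init (X p') i) differentiable (at p)"
    "(\<lambda>p'. rho_init (X p') i) differentiable (at p)"
    if "i \<in> {1..s}" for i
    using diff that unfolding cell_differentiable_at_def by auto

  have fu_deriv: "((\<lambda>p'. fu i m (X p')) has_derivative (\<lambda>\<zeta>. - 2 * Vx i m \<zeta>)) (at p)"
    if "i \<in> {1..s}" "m \<in> {1..r}" for i m
    unfolding fu_def stage_defs d_def
    by (intro has_derivative_mult_right cell_d_has_derivative diff_stage that)
  \<comment> \<open>The square is the only nonlinearity of the scheme; it contributes a multiple of
    \<open>U i m\<close> itself.\<close>
  have frho_deriv: "((\<lambda>p'. frho i m (X p')) has_derivative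
      (\<lambda>\<zeta>. - 2 * \<beta> * Wx i m \<zeta> + 2 * V i m \<zeta> - 2 * stage_u (X p) i m * U i m \<zeta>)) (at p)"
    if "i \<in> {1..s}" "m \<in> {1..r}" for i m
    unfolding frho_def stage_defs d_def
    by (rule derivative_eq_intros cell_d_has_derivative diff_stage that refl)+
      (simp add: algebra_simps)
  have diff_flux: "(\<lambda>p'. fu i m (X p')) differentiable (at p)"
      "(\<lambda>p'. frho i m (X p')) differentiable (at p)"
    if "i \<in> {1..s}" "m \<in> {1..r}" for i m
    using fu_deriv[OF that] frho_deriv[OF that] unfolding differentiable_def by blast+
  have d_flux: "d (fu i m) = (\<lambda>\<zeta>. - 2 * Vx i m \<zeta>)"
      "d (frho i m) = (\<lambda>\<zeta>. - 2 * \<beta> * Wx i m \<zeta> + 2 * V i m \<zeta> - 2 * stage_u (X p) i m * U i m \<zeta>)"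
    if "i \<in> {1..s}" "m \<in> {1..r}" for i m
    unfolding d_def using fu_deriv[OF that] frho_deriv[OF that] by (auto intro: cell_d_eqI)

  note rk_eqs = splitting_rk_equations[OF rk]
  note step_noise = cell_d_rk_step[OF S, of _ X, folded d_def]
  note step = step_noise[where e = 0, unfolded add_0_right]

  have space_stage:
    "V i m \<zeta> = d (\<lambda>Y. v_left Y m) \<zeta> + dx * (\<Sum>j=1..s. a i j * Vx j m \<zeta>)"
    "W i m \<zeta> = d (\<lambda>Y. w_left Y m) \<zeta> + dx * (\<Sum>j=1..s. a i j * Wx j m \<zeta>)"
    "U i m \<zeta> = d (\<lambda>Y. u_left Y m) \<zeta> + dx * (\<Sum>j=1..s. a i j * W j m \<zeta>)"
    "P i m \<zeta> = d (\<lambda>Y. rho_left Y m) \<zeta> + dx * (\<Sum>j=1..s. a i j * U j m \<zeta>)"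
    if "i \<in> {1..s}" "m \<in> {1..r}" for i m \<zeta>
    unfolding stage_defs
    \<comment> \<open>Each pass of the outer repetition linearizes one relation: first the scheme
      equation on \<open>S\<close>, then differentiability of the starting value and of the
      slopes.\<close>
    by (rule step,
        rule rk_eqs, assumption, (rule that)+,
        (intro diff_left diff_stage that; assumption)+)+
  have space_update:
    "d (\<lambda>Y. v_right Y m) \<zeta> = d (\<lambda>Y. v_left Y m) \<zeta> + dx * (\<Sum>i=1..s. b i * Vx i m \<zeta>)"
    "d (\<lambda>Y. w_right Y m) \<zeta> = d (\<lambda>Y. w_left Y m) \<zeta> + dx * (\<Sum>i=1..s. b i * Wx i m \<zeta>)"
    "d (\<lambda>Y. u_right Y m) \<zeta> = d (\<lambda>Y. u_left Y m) \<zeta> + dx * (\<Sum>i=1..s. b i * W i m \<zeta>)"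
    "d (\<lambda>Y. rho_right Y m) \<zeta> = d (\<lambda>Y. rho_left Y m) \<zeta> + dx * (\<Sum>i=1..s. b i * U i m \<zeta>)"
    if "m \<in> {1..r}" for m \<zeta>
    unfolding stage_defs
    by (rule step,
        rule rk_eqs, assumption, (rule that)+,
        (intro diff_left diff_stage that; assumption)+)+
  \<comment> \<open>The same forms \<open>U\<close> and \<open>P\<close> already obey the spatial
    stage relations. This double role is what makes the summands in time and in space
    comparable.\<close>
  have time_stage:
    "U i m \<zeta> = d (\<lambda>Y. u_init Y i) \<zeta> + dt * (\<Sum>n=1..r. a' m n * d (fu i n) \<zeta>)"
    "P i m \<zeta> = d (\<lambda>Y. rho_init Y i) \<zeta> + dt * (\<Sum>n=1..r. a' m n * d (frho i n) \<zeta>)"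
    if "i \<in> {1..s}" "m \<in> {1..r}" for i m \<zeta>
    unfolding stage_defs
    by (rule step,
        (simp only: fu_def frho_def)[1], rule rk_eqs, assumption, (rule that)+,
        (intro diff_init diff_flux that; assumption)+)+
  \<comment> \<open>Only this update contains noise. The increment takes the place of the constant
    \<open>e\<close> and leaves no trace in the differential.\<close>
  have u_update:
    "d (\<lambda>Y. u_fin Y i) \<zeta> = d (\<lambda>Y. u_init Y i) \<zeta> + dt * (\<Sum>m=1..r. b' m * d (fu i m) \<zeta>)"
    if "i \<in> {1..s}" for i \<zeta>
    by (rule step_noise[where e = "2 * lam * dW i"],
        (simp only: fu_def)[1], rule rk_eqs, assumption, (rule that)+,
        (intro diff_init diff_flux that; assumption)+)
  have rho_update:
    "d (\<lambda>Y. rho_fin Y i) \<zeta> = d (\<lambda>Y. rho_init Y i) \<zeta> + dt * (\<Sum>m=1..r. b' m * d (frho i m) \<zeta>)"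
    if "i \<in> {1..s}" for i \<zeta>
    by (rule step,
        (simp only: frho_def)[1], rule rk_eqs, assumption, (rule that)+,
        (intro diff_init diff_flux that; assumption)+)

  have time: "(d (\<lambda>Y. rho_fin Y i) \<^bold>\<and> d (\<lambda>Y. u_fin Y i)) \<xi> \<eta>
      - (d (\<lambda>Y. rho_init Y i) \<^bold>\<and> d (\<lambda>Y. u_init Y i)) \<xi> \<eta> =
      dt * (\<Sum>m=1..r. b' m * (2 * (V i m \<^bold>\<and> U i m) \<xi> \<eta>
        - 2 * \<beta> * (Wx i m \<^bold>\<and> U i m) \<xi> \<eta> - 2 * (P i m \<^bold>\<and> Vx i m) \<xi> \<eta>))"
    if i: "i \<in> {1..s}" for i
  proof -
    have "(d (\<lambda>Y. rho_fin Y i) \<^bold>\<and> d (\<lambda>Y. u_fin Y i)) \<xi> \<eta>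
        - (d (\<lambda>Y. rho_init Y i) \<^bold>\<and> d (\<lambda>Y. u_init Y i)) \<xi> \<eta> =
        dt * (\<Sum>m=1..r. b' m *
          ((d (frho i m) \<^bold>\<and> U i m) \<xi> \<eta> + (P i m \<^bold>\<and> d (fu i m)) \<xi> \<eta>))"
      by (rule rk_symplectic_wedge[OF symp'])
        (rule time_stage u_update rho_update; use i in simp)+
    \<comment> \<open>The quadratic part of the flux pairs \<open>U i m\<close> with itself and
      drops out by antisymmetry.\<close>
    also have "(\<Sum>m=1..r. b' m *
          ((d (frho i m) \<^bold>\<and> U i m) \<xi> \<eta> + (P i m \<^bold>\<and> d (fu i m)) \<xi> \<eta>)) =
        (\<Sum>m=1..r. b' m * (2 * (V i m \<^bold>\<and> U i m) \<xi> \<eta>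
          - 2 * \<beta> * (Wx i m \<^bold>\<and> U i m) \<xi> \<eta> - 2 * (P i m \<^bold>\<and> Vx i m) \<xi> \<eta>))"
      by (intro sum.cong refl) (simp add: d_flux[OF i] wedge_def algebra_simps)
    finally show ?thesis .
  qed
  have space: "(d (\<lambda>Y. rho_right Y m) \<^bold>\<and> d (\<lambda>Y. v_right Y m)) \<xi> \<eta>
      - (d (\<lambda>Y. rho_left Y m) \<^bold>\<and> d (\<lambda>Y. v_left Y m)) \<xi> \<eta>
      + \<beta> * (d (\<lambda>Y. w_right Y m) \<^bold>\<and> d (\<lambda>Y. u_right Y m)) \<xi> \<eta>
      - \<beta> * (d (\<lambda>Y. w_left Y m) \<^bold>\<and> d (\<lambda>Y. u_left Y m)) \<xi> \<eta> =
      dx * (\<Sum>i=1..s. b i * ((P i m \<^bold>\<and> Vx i m) \<xi> \<eta> - (V i m \<^bold>\<and> U i m) \<xi> \<eta>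
        + \<beta> * (Wx i m \<^bold>\<and> U i m) \<xi> \<eta>))"
    if m: "m \<in> {1..r}" for m
  proof -
    have rho_v: "(d (\<lambda>Y. rho_right Y m) \<^bold>\<and> d (\<lambda>Y. v_right Y m)) \<xi> \<eta>
        - (d (\<lambda>Y. rho_left Y m) \<^bold>\<and> d (\<lambda>Y. v_left Y m)) \<xi> \<eta> =
        dx * (\<Sum>i=1..s. b i * ((U i m \<^bold>\<and> V i m) \<xi> \<eta> + (P i m \<^bold>\<and> Vx i m) \<xi> \<eta>))"
      by (rule rk_symplectic_wedge[OF symp])
        (rule space_stage space_update; use m in simp)+
    \<comment> \<open>Since the spatial slope of u is the stage value of w, the second term is the
      wedge of \<open>W i m\<close> with itself, which vanishes when the two rules are combined
      below.\<close>
    have w_u: "(d (\<lambda>Y. w_right Y m) \<^bold>\<and> d (\<lambda>Y. u_right Y m)) \<xi> \<eta>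
        - (d (\<lambda>Y. w_left Y m) \<^bold>\<and> d (\<lambda>Y. u_left Y m)) \<xi> \<eta> =
        dx * (\<Sum>i=1..s. b i * ((Wx i m \<^bold>\<and> U i m) \<xi> \<eta> + (W i m \<^bold>\<and> W i m) \<xi> \<eta>))"
      by (rule rk_symplectic_wedge[OF symp])
        (rule space_stage space_update; use m in simp)+
    have "(d (\<lambda>Y. rho_right Y m) \<^bold>\<and> d (\<lambda>Y. v_right Y m)) \<xi> \<eta>
        - (d (\<lambda>Y. rho_left Y m) \<^bold>\<and> d (\<lambda>Y. v_left Y m)) \<xi> \<eta>
        + \<beta> * (d (\<lambda>Y. w_right Y m) \<^bold>\<and> d (\<lambda>Y. u_right Y m)) \<xi> \<eta>
        - \<beta> * (d (\<lambda>Y. w_left Y m) \<^bold>\<and> d (\<lambda>Y. u_left Y m)) \<xi> \<eta> =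
        dx * (\<Sum>i=1..s. b i * ((U i m \<^bold>\<and> V i m) \<xi> \<eta> + (P i m \<^bold>\<and> Vx i m) \<xi> \<eta>))
        + \<beta> * (dx * (\<Sum>i=1..s. b i * ((Wx i m \<^bold>\<and> U i m) \<xi> \<eta> + (W i m \<^bold>\<and> W i m) \<xi> \<eta>)))"
      unfolding rho_v[symmetric] w_u[symmetric] by (simp add: algebra_simps)
    then show ?thesis
      by (simp add: wedge_def sum_distrib_left sum.distrib[symmetric] algebra_simps)
  qed
  \<comment> \<open>The summand in \<open>time\<close> is -2 times the one in \<open>space\<close>.
    The factor 2 in the spatial weights of the law compensates for this, and dividing by the step
    sizes leaves the common weight \<open>2 * b' m * b i\<close>.\<close>
  have time_sum: "(\<Sum>i=1..s. b i / dt *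
          ((d (\<lambda>Y. rho_fin Y i) \<^bold>\<and> d (\<lambda>Y. u_fin Y i)) \<xi> \<eta>
           - (d (\<lambda>Y. rho_init Y i) \<^bold>\<and> d (\<lambda>Y. u_init Y i)) \<xi> \<eta>)) =
      - (\<Sum>i=1..s. \<Sum>m=1..r. 2 * b' m * b i * ((P i m \<^bold>\<and> Vx i m) \<xi> \<eta>
        - (V i m \<^bold>\<and> U i m) \<xi> \<eta> + \<beta> * (Wx i m \<^bold>\<and> U i m) \<xi> \<eta>))"
    using \<open>dt \<noteq> 0\<close> unfolding sum_negf[symmetric]
    by (intro sum.cong refl) (simp add: time sum_distrib_left sum_negf[symmetric] algebra_simps)
  have "(\<Sum>m=1..r. 2 * b' m / dx *
          ((d (\<lambda>Y. rho_right Y m) \<^bold>\<and> d (\<lambda>Y. v_right Y m)) \<xi> \<eta>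
           - (d (\<lambda>Y. rho_left Y m) \<^bold>\<and> d (\<lambda>Y. v_left Y m)) \<xi> \<eta>
           + \<beta> * (d (\<lambda>Y. w_right Y m) \<^bold>\<and> d (\<lambda>Y. u_right Y m)) \<xi> \<eta>
           - \<beta> * (d (\<lambda>Y. w_left Y m) \<^bold>\<and> d (\<lambda>Y. u_left Y m)) \<xi> \<eta>)) =
      (\<Sum>m=1..r. \<Sum>i=1..s. 2 * b' m * b i * ((P i m \<^bold>\<and> Vx i m) \<xi> \<eta>
        - (V i m \<^bold>\<and> U i m) \<xi> \<eta> + \<beta> * (Wx i m \<^bold>\<and> U i m) \<xi> \<eta>))"
    using \<open>dx \<noteq> 0\<close>
    by (intro sum.cong refl) (simp add: space sum_distrib_left mult.assoc)
  also have "\<dots> = (\<Sum>i=1..s. \<Sum>m=1..r. 2 * b' m * b i * ((P i m \<^bold>\<and> Vx i m) \<xi> \<eta>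
        - (V i m \<^bold>\<and> U i m) \<xi> \<eta> + \<beta> * (Wx i m \<^bold>\<and> U i m) \<xi> \<eta>))"
    by (rule sum.swap)
  finally have space_sum: "(\<Sum>m=1..r. 2 * b' m / dx *
          ((d (\<lambda>Y. rho_right Y m) \<^bold>\<and> d (\<lambda>Y. v_right Y m)) \<xi> \<eta>
           - (d (\<lambda>Y. rho_left Y m) \<^bold>\<and> d (\<lambda>Y. v_left Y m)) \<xi> \<eta>
           + \<beta> * (d (\<lambda>Y. w_right Y m) \<^bold>\<and> d (\<lambda>Y. u_right Y m)) \<xi> \<eta>
           - \<beta> * (d (\<lambda>Y. w_left Y m) \<^bold>\<and> d (\<lambda>Y. u_left Y m)) \<xi> \<eta>)) =
      (\<Sum>i=1..s. \<Sum>m=1..r. 2 * b' m * b i * ((P i m \<^bold>\<and> Vx i m) \<xi> \<eta>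
        - (V i m \<^bold>\<and> U i m) \<xi> \<eta> + \<beta> * (Wx i m \<^bold>\<and> U i m) \<xi> \<eta>))" .
  show ?thesis
    unfolding time_sum space_sum by simp
qed

theorem theorem4p4:
  fixes M :: "'w measure" and D :: "real set"
    and Q :: "(real \<Rightarrow> real) \<Rightarrow> real \<Rightarrow> real"
    and W :: "real \<Rightarrow> 'w \<Rightarrow> real \<Rightarrow> real"
    and s r :: nat
    and a a' :: "nat \<Rightarrow> nat \<Rightarrow> real" and b b' :: "nat \<Rightarrow> real"
    and dx dt \<beta> lam :: real
    and S :: "'w \<Rightarrow> 'p::real_normed_vector set"
    and X :: "'w \<Rightarrow> 'p \<Rightarrow> kdv_cell"
  assumes "s \<ge> 1" and "r \<ge> 1" and "\<beta> > 0" and "lam > 0" and "dx > 0" and "dt > 0"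
    and "{0..dx} \<subseteq> D"
    and "Q_Wiener_process M D Q W"
    and "rk_symplectic s a b" and "rk_symplectic r a' b'"
    and "AE \<omega> in M. open (S \<omega>) \<and>
           (\<forall>p\<in>S \<omega>.
              splitting_rk s a b r a' b' dx dt \<beta> lam
                (\<lambda>i. W dt \<omega> (rk_abscissa s a i * dx) - W 0 \<omega> (rk_abscissa s a i * dx)) (X \<omega> p) \<and>
              cell_differentiable_at s r (X \<omega>) p)"
  shows "AE \<omega> in M. \<forall>p\<in>S \<omega>. \<forall>\<xi> \<eta>.
    (let d = cell_d (X \<omega>) p in
       (\<Sum>i=1..s. b i / dt *
          ((d (\<lambda>Y. rho_fin Y i) \<^bold>\<and> d (\<lambda>Y. u_fin Y i)) \<xi> \<eta>
           - (d (\<lambda>Y. rho_init Y i) \<^bold>\<and> d (\<lambda>Y. u_init Y i)) \<xi> \<eta>))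
       + (\<Sum>m=1..r. 2 * b' m / dx *
          ((d (\<lambda>Y. rho_right Y m) \<^bold>\<and> d (\<lambda>Y. v_right Y m)) \<xi> \<eta>
           - (d (\<lambda>Y. rho_left Y m) \<^bold>\<and> d (\<lambda>Y. v_left Y m)) \<xi> \<eta>
           + \<beta> * (d (\<lambda>Y. w_right Y m) \<^bold>\<and> d (\<lambda>Y. u_right Y m)) \<xi> \<eta>
           - \<beta> * (d (\<lambda>Y. w_left Y m) \<^bold>\<and> d (\<lambda>Y. u_left Y m)) \<xi> \<eta>))
     = 0)"
  \<comment> \<open>The pathwise identity is applied on the almost sure event where the scheme
    holds. There the increments depend on the realization and on the stage \<open>i\<close>, but not
    on the parameter, so they serve as \<open>dW\<close>.\<close>
  using assms(11)
proof eventually_elim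
  case (elim \<omega>)
  show ?case
    unfolding Let_def
    by (intro ballI allI splitting_rk_multisymplectic[where S = "S \<omega>"])
      (use elim \<open>dx > 0\<close> \<open>dt > 0\<close> \<open>rk_symplectic s a b\<close> \<open>rk_symplectic r a' b'\<close> in auto)
qed

end
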